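(* Let $d,k\ge 1$ be integers, let $\lambda=-\frac32 d^2+dk+\frac12 d$, $h=\left|\frac{2\lambda}{d}\right|$, and $t=d+h+2$. For $m\ge 0$ define $$\alpha_{d,k,m}(a,q)=\begin{cases}\dfrac{(-1)^r a^{(k-d)r}q^{(dk-d^2+\frac d2)r^2-\frac d2 r}(aq^{2d};q^{2d})_r(a;q^d)_r}{(a;q^{2d})_r(q^d;q^d)_r} & \text{if } m=dr \text{ for some integer } r\ge 0,\\[2mm] 0&\text{otherwise,}\end{cases}$$ and for $n\ge 0$ define $$\beta_{d,k,n}(a,q)=\begin{cases}\displaystyle\lim_{\tau\to 0}\frac{{}_{t+1}W_t\left(a;\nu_1,\dots,\nu_h,\mu_1,\dots,\mu_d;q^d,\tau^h a^{k-d}q^{nd}\right)}{(q;q)_n(aq;q)_n} & \text{if }\lambda\ge 0,\\[4mm] \displaystyle\lim_{\tau\to 0}\frac{{}_{t+1}W_t\left(a;\delta_1,\dots,\delta_h,\mu_1,\dots,\mu_d;q^d,\dfrac{a^{k-d}q^{nd}}{\tau^h}\right)}{(q;q)_n(aq;q)_n} & \text{if }\lambda<0,\end{cases}$$ where $\nu_j=\dfrac{q^{\lambda/h}}{\tau}$ and $\delta_j=\tau a q^{d+\lambda/h}$ for $1\le j\le h$, and $\mu_j=q^{d-j-n}$ for $1\le j\le d$ (when $\lambda=0$ we have $h=0$ and there are no $\nu_j$). Then $(\alpha_{d,k,m}(a,q),\beta_{d,k,n}(a,q))$ form a Bailey pair, i.e. for all $n\ge 0$, $$\beta_{d,k,n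}(a,q)=\sum_{m=0}^n\frac{\alpha_{d,k,m}(a,q)}{(q;q)_{n-m}(aq;q)_{n+m}}.$$
   Context: $|q|<1$ and $a$ is a generic parameter (no denominators vanish). $(x;q)_m=\prod_{j=0}^{m-1}(1-xq^j)$, and $(x_1,\dots,x_p;q)_m=(x_1;q)_m\cdots(x_p;q)_m$. The basic hypergeometric series is $${}_{s+1}\phi_s\left[\begin{matrix}a_1,\dots,a_{s+1}\\ b_1,\dots,b_s\end{matrix};q,z\right]=\sum_{r=0}^\infty\frac{(a_1,\dots,a_{s+1};q)_r}{(q,b_1,\dots,b_s;q)_r}z^r,$$ and the very-well-poised series is $${}_{s+1}W_s(a_1;a_4,\dots,a_{s+1};q,z)={}_{s+1}\phi_s\left[\begin{matrix}a_1,\,qa_1^{1/2},\,-qa_1^{1/2},\,a_4,\dots,a_{s+1}\\ a_1^{1/2},\,-a_1^{1/2},\,\frac{qa_1}{a_4},\dots,\frac{qa_1}{a_{s+1}}\end{matrix};q,z\right].$$ In the claim, this is used with base $q^d$ in place of $q$. Since some $\mu_j$ is of the form $q^{-ds}$ with $s\ge 0$ an integer, the series terminates. *)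

theory Defs
  imports Complex_Main "HOL-Analysis.Complex_Transcendental"
begin

definition qpoch :: "complex \<Rightarrow> complex \<Rightarrow> nat \<Rightarrow> complex" where
  "qpoch x q m = (\<Prod>j<m. 1 - x * q ^ j)"

definition qpochs :: "complex list \<Rightarrow> complex \<Rightarrow> nat \<Rightarrow> complex" where
  "qpochs xs q m = (\<Prod>x\<leftarrow>xs. qpoch x q m)"

(* The subscripts of _{s+1}phi_s and _{s+1}W_s are carried by the lengths of the lists:
   length as = s + 1 and length bs = s in the first definition,
   length xs = s - 2 (xs lists a_4, ..., a_{s+1}) in the second. *)
definition basic_hyp :: "complex list \<Rightarrow> complex list \<Rightarrow> complex \<Rightarrow> complex \<Rightarrow> complex" where
  "basic_hyp as bs q z = (\<Sum>r. qpochs as q r / qpochs (q # bs) q r * z ^ r)"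

(* Both square roots of a occur symmetrically, so the choice made by csqrt is immaterial. *)
definition vwp_series :: "complex \<Rightarrow> complex list \<Rightarrow> complex \<Rightarrow> complex \<Rightarrow> complex" where
  "vwp_series a xs q z =
     basic_hyp ([a, q * csqrt a, - q * csqrt a] @ xs)
               ([csqrt a, - csqrt a] @ map (\<lambda>x. q * a / x) xs) q z"

definition bailey_pair ::
    "complex \<Rightarrow> complex \<Rightarrow> (nat \<Rightarrow> complex) \<Rightarrow> (nat \<Rightarrow> complex) \<Rightarrow> bool" where
  "bailey_pair a q \<alpha> \<beta> \<longleftrightarrow>
     (\<forall>n. \<beta> n = (\<Sum>m=0..n. \<alpha> m / (qpoch q q (n - m) * qpoch (a * q) q (n + m))))"

(* The real power q^x, where L is a chosen logarithm of q (exp L = q). Every branch of the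
   fractional powers of q arises in this way; L = Ln q gives the principal one. *)
definition qpow :: "complex \<Rightarrow> real \<Rightarrow> complex" where
  "qpow L x = exp (of_real x * L)"

definition lam :: "nat \<Rightarrow> nat \<Rightarrow> real" where
  "lam d k = - (3/2) * real d ^ 2 + real d * real k + real d / 2"

(* 2 * lam d k / d = 2k - 3d + 1 is an integer, so the floor does not round;
   see real_hpar below. *)
definition hpar :: "nat \<Rightarrow> nat \<Rightarrow> nat" where
  "hpar d k = nat \<lfloor>\<bar>2 * lam d k / real d\<bar>\<rfloor>"

lemma real_hpar:
  assumes "d \<ge> 1"
  shows "real (hpar d k) = \<bar>2 * lam d k / real d\<bar>"
proof -
  have "2 * lam d k / real d = of_int (2 * int k - 3 * int d + 1)"
    using assms by (simp add: lam_def field_simps power2_eq_square)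
  then have "\<bar>2 * lam d k / real d\<bar> = of_int \<bar>2 * int k - 3 * int d + 1\<bar>"
    by simp
  then show ?thesis
    unfolding hpar_def by (metis abs_ge_zero floor_of_int of_int_of_nat_eq nat_0_le)
qed

(* The exponent of q is an integer, so the value depends on L only through q = exp L. *)
definition bp_alpha ::
    "nat \<Rightarrow> nat \<Rightarrow> complex \<Rightarrow> complex \<Rightarrow> complex \<Rightarrow> nat \<Rightarrow> complex" where
  "bp_alpha d k a q L m =
     (if d dvd m then
        (let r = m div d in
           (-1) ^ r * a powi ((int k - int d) * int r)
           * qpow L ((real d * real k - real d ^ 2 + real d / 2) * real r ^ 2
                      - real d / 2 * real r)
           * qpoch (a * q ^ (2 * d)) (q ^ (2 * d)) r * qpoch a (q ^ d) r
           / (qpoch a (q ^ (2 * d)) r * qpoch (q ^ d) (q ^ d) r))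
      else 0)"

definition nus :: "nat \<Rightarrow> nat \<Rightarrow> complex \<Rightarrow> complex \<Rightarrow> complex list" where
  "nus d k L \<tau> = replicate (hpar d k) (qpow L (lam d k / real (hpar d k)) / \<tau>)"

definition deltas :: "nat \<Rightarrow> nat \<Rightarrow> complex \<Rightarrow> complex \<Rightarrow> complex \<Rightarrow> complex list" where
  "deltas d k a L \<tau> =
     replicate (hpar d k) (\<tau> * a * qpow L (real d + lam d k / real (hpar d k)))"

definition mus :: "nat \<Rightarrow> complex \<Rightarrow> nat \<Rightarrow> complex list" where
  "mus d q n = map (\<lambda>j. q powi (int d - int j - int n)) [1..<d + 1]"

definition bp_beta_pre ::
    "nat \<Rightarrow> nat \<Rightarrow> complex \<Rightarrow> complex \<Rightarrow> complex \<Rightarrow> nat \<Rightarrow> complex \<Rightarrow> complex" where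
  "bp_beta_pre d k a q L n \<tau> =
     (if lam d k \<ge> 0 then
        vwp_series a (nus d k L \<tau> @ mus d q n) (q ^ d)
          (\<tau> ^ hpar d k * a powi (int k - int d) * q ^ (n * d))
      else
        vwp_series a (deltas d k a L \<tau> @ mus d q n) (q ^ d)
          (a powi (int k - int d) * q ^ (n * d) / \<tau> ^ hpar d k))
     / (qpoch q q n * qpoch (a * q) q n)"

definition bp_beta ::
    "nat \<Rightarrow> nat \<Rightarrow> complex \<Rightarrow> complex \<Rightarrow> complex \<Rightarrow> nat \<Rightarrow> complex" where
  "bp_beta d k a q L n = Lim (at 0) (bp_beta_pre d k a q L n)"

end

theory Submission
  imports Defs
begin

text \<open>
  Once the limit in \<open>\<tau>\<close> is taken term by term, the defining sum of a Bailey pair appears with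
  the term of index \<open>r\<close> of the very-well-poised series sitting at \<open>m = d r\<close>.  Three observations
  make this precise.

  The parameters \<open>\<mu>\<^sub>1, \<dots>, \<mu>\<^sub>d\<close> are the numbers \<open>q\<^sup>i / q\<^sup>n\<close> with \<open>0 \<le> i < d\<close>, so their factorials
  in base \<open>q\<^sup>d\<close> merge into the single factorial \<open>(1/q\<^sup>n; q)\<close> of length \<open>d r\<close>, and their
  well-poised companions merge in the same way (\<open>qpochs_mus\<close>, \<open>qpochs_mus_companion\<close>).  The first
  vanishes as soon as \<open>d r > n\<close>; hence the series is a finite sum whose range does not depend on
  \<open>\<tau>\<close>, and the limit may be taken termwise (\<open>vwp_series_mus\<close>).  For \<open>m = d r \<le> n\<close>,
  reversing the product turns \<open>(1/q\<^sup>n; q)\<close> into \<open>(q;q)\<close> at \<open>n\<close> over \<open>(q;q)\<close> at \<open>n - m\<close>, with a sign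
  and the \<open>m choose 2\<close> power of \<open>q\<close> (\<open>qpoch_inverse_power\<close>), and this together with
  \<open>qpoch_add\<close> produces the two denominators of the Bailey sum.

  Each of the \<open>h\<close> parameters depending on \<open>\<tau>\<close> contributes a confluent limit, in which
  \<open>\<tau>\<^sup>r (c/\<tau>; Q)\<close> tends to \<open>(-c)\<^sup>r\<close> times a quadratic power of \<open>Q\<close>.  In the case \<open>\<lambda> \<ge> 0\<close> this
  factor is in the numerator, in the case \<open>\<lambda> < 0\<close> in the denominator; since \<open>d h = 2 \<bar>\<lambda>\<bar>\<close>, the total
  contribution is \<open>(-1)\<close> to the power \<open>h r\<close> times \<open>q\<close> to the power \<open>\<lambda> r\<^sup>2\<close> in both cases
  (\<open>tendsto_nus_factor\<close>, \<open>tendsto_deltas_factor\<close>).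

  It remains to collect signs and powers of \<open>q\<close>: \<open>h\<close> and \<open>d\<close> have opposite parity, so the signs
  combine to \<open>(-1)\<^sup>r\<close>, and \<open>\<lambda> r\<^sup>2 + d r (d r - 1) / 2\<close> is the exponent in \<open>\<alpha>\<close>
  (\<open>limit_term_eq_alpha\<close>).
\<close>

section \<open>Shifted factorials\<close>

lemma qpoch_0 [simp]: "qpoch x q 0 = 1"
  by (simp add: qpoch_def)

lemma qpoch_Suc: "qpoch x q (Suc m) = qpoch x q m * (1 - x * q ^ m)"
  by (simp add: qpoch_def)

lemma qpoch_add: "qpoch x q (m + n) = qpoch x q m * qpoch (x * q ^ m) q n"
  by (induction n) (simp_all add: qpoch_Suc power_add mult_ac)

lemma qpoch_eq_0_iff: "qpoch x q m = 0 \<longleftrightarrow> (\<exists>j<m. x * q ^ j = 1)"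
  by (auto simp: qpoch_def)

lemma qpoch_self_nonzero:
  assumes "norm q < 1"
  shows "qpoch q q m \<noteq> 0"
proof -
  have "q * q ^ j \<noteq> 1" for j
  proof -
    have "norm (q ^ Suc j) < 1"
      using assms by (simp only: norm_power) (simp add: power_less_one_iff del: power_Suc)
    then show ?thesis
      by (metis norm_one order_less_irrefl power_Suc)
  qed
  then show ?thesis
    by (simp add: qpoch_eq_0_iff)
qed

text \<open>
  This removes the square roots from the very-well-poised series, whichever branch they are on.
\<close>

lemma qpoch_mult_qpoch_uminus: "qpoch s q r * qpoch (- s) q r = qpoch (s\<^sup>2) (q\<^sup>2) r"
proof -
  have "(1 - s * q ^ j) * (1 + s * q ^ j) = 1 - s\<^sup>2 * (q\<^sup>2) ^ j" for j
    by (simp add: algebra_simps power2_eq_square power_mult_distrib)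
  then show ?thesis
    by (simp add: qpoch_def flip: prod.distrib)
qed

text \<open>
  Every exponent below \<open>d r\<close> is \<open>i + d j\<close> for exactly one residue \<open>i < d\<close> and one \<open>j < r\<close>.
\<close>

lemma qpoch_dissection: "(\<Prod>i<d. qpoch (x * q ^ i) (q ^ d) r) = qpoch x q (d * r)"
proof (induction r)
  case (Suc r)
  have "qpoch x q (d * Suc r) = qpoch x q (d * r) * qpoch (x * q ^ (d * r)) q d"
    by (simp add: add.commute flip: qpoch_add)
  moreover have "qpoch (x * q ^ (d * r)) q d = (\<Prod>i<d. 1 - x * q ^ i * (q ^ d) ^ r)"
    by (simp add: qpoch_def mult_ac flip: power_mult)
  ultimately show ?case
    using Suc by (simp add: qpoch_Suc prod.distrib)
qed simp

text \<open>
  Reversal of a terminating factorial: the factor \<open>1 - q\<^sup>j / q\<^sup>n\<close> is \<open>- q\<^sup>j / q\<^sup>n\<close> times the factor of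
  \<open>(q;q)\<close> with exponent \<open>n - j\<close>.  The power \<open>q ^ (n * m)\<close> clears the denominators; it is exactly the
  one that the argument of the series supplies.
\<close>

lemma qpoch_inverse_power:
  assumes "q \<noteq> 0" and "m \<le> n"
  shows "q ^ (n * m) * qpoch (inverse (q ^ n)) q m * qpoch q q (n - m)
           = (-1) ^ m * q ^ (m choose 2) * qpoch q q n"
  using assms(2)
proof (induction m)
  case (Suc m)
  let ?x = "inverse (q ^ n)"
  have nm: "n - m = Suc (n - Suc m)"
    using Suc.prems by simp
  have "q ^ n = q ^ m * (q * q ^ (n - Suc m))"
    using Suc.prems by (simp flip: power_add power_Suc)
  moreover have "q ^ n * ?x = 1"
    using assms(1) by simp
  ultimately have factor: "q ^ n * (1 - ?x * q ^ m) = - (q ^ m * (1 - q * q ^ (n - Suc m)))"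
    by (simp add: algebra_simps)
  have "q ^ (n * Suc m) * qpoch ?x q (Suc m) * qpoch q q (n - Suc m)
      = q ^ (n * m) * qpoch ?x q m * qpoch q q (n - Suc m) * (q ^ n * (1 - ?x * q ^ m))"
    by (simp add: qpoch_Suc power_add mult_ac)
  also have "\<dots> = - (q ^ m) * (q ^ (n * m) * qpoch ?x q m * qpoch q q (n - m))"
    unfolding factor nm by (simp add: qpoch_Suc mult_ac)
  also have "\<dots> = - (q ^ m) * ((-1) ^ m * q ^ (m choose 2) * qpoch q q n)"
    using Suc by simp
  also have "\<dots> = (-1) ^ Suc m * q ^ (Suc m choose 2) * qpoch q q n"
    by (simp add: numeral_2_eq_2 power_add mult_ac)
  finally show ?case .
qed (simp add: numeral_2_eq_2)

section \<open>Terms of the very-well-poised series\<close>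

lemma qpochs_append: "qpochs (xs @ ys) q r = qpochs xs q r * qpochs ys q r"
  by (simp add: qpochs_def)

lemma qpochs_replicate: "qpochs (replicate h x) q r = qpoch x q r ^ h"
  by (simp add: qpochs_def)

lemma vwp_series_eq:
  "vwp_series a xs q z =
     (\<Sum>r. qpoch a q r * qpoch (a * q\<^sup>2) (q\<^sup>2) r / (qpoch a (q\<^sup>2) r * qpoch q q r)
          * (qpochs xs q r / qpochs (map (\<lambda>x. q * a / x) xs) q r) * z ^ r)"
proof -
  have num: "qpoch (a * q\<^sup>2) (q\<^sup>2) r = qpoch (q * csqrt a) q r * qpoch (- q * csqrt a) q r" for r
    using qpoch_mult_qpoch_uminus[of "q * csqrt a" q r]
    by (simp add: power_mult_distrib mult.commute)
  have den: "qpoch a (q\<^sup>2) r = qpoch (csqrt a) q r * qpoch (- csqrt a) q r" for r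
    by (simp add: qpoch_mult_qpoch_uminus)
  show ?thesis
    unfolding vwp_series_def basic_hyp_def num den
    by (simp add: qpochs_def mult_ac)
qed

text \<open>
  The parameters \<open>\<mu>\<^sub>j\<close> run through the residues modulo \<open>d\<close> in decreasing order, their companions
  in increasing order, and \<open>qpoch_dissection\<close> applies to both.
\<close>

lemma qpochs_mus:
  assumes "q \<noteq> 0"
  shows "qpochs (mus d q n) (q ^ d) r = qpoch (inverse (q ^ n)) q (d * r)"
proof -
  have "qpochs (mus d q n) (q ^ d) r
      = (\<Prod>j=1..<d+1. qpoch (q powi (int d - int j - int n)) (q ^ d) r)"
    unfolding qpochs_def mus_def
    by (simp add: prod.distinct_set_conv_list[symmetric] del: upt_Suc)
  also have "\<dots> = (\<Prod>i<d. qpoch (inverse (q ^ n) * q ^ i) (q ^ d) r)"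
  proof (rule prod.reindex_bij_witness[where i = "\<lambda>i. d - i" and j = "\<lambda>j. d - j"])
    fix j assume j: "j \<in> {1..<d+1}"
    then have "j \<le> d" by simp
    then obtain i where i: "d = j + i"
      using le_Suc_ex by blast
    have "q powi (int d - int j - int n) = inverse (q ^ n) * q ^ (d - j)"
      using assms by (simp add: i power_int_diff divide_inverse mult.commute)
    then show "qpoch (inverse (q ^ n) * q ^ (d - j)) (q ^ d) r
        = qpoch (q powi (int d - int j - int n)) (q ^ d) r"
      by simp
  qed auto
  finally show ?thesis
    by (simp add: qpoch_dissection)
qed

lemma qpochs_mus_companion:
  assumes "q \<noteq> 0"
  shows "qpochs (map (\<lambda>x. q ^ d * a / x) (mus d q n)) (q ^ d) r
           = qpoch (a * q * q ^ n) q (d * r)"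
proof -
  have "qpochs (map (\<lambda>x. q ^ d * a / x) (mus d q n)) (q ^ d) r
      = (\<Prod>j=1..<d+1. qpoch (q ^ d * a / q powi (int d - int j - int n)) (q ^ d) r)"
    unfolding qpochs_def mus_def
    by (simp add: prod.distinct_set_conv_list[symmetric] o_def del: upt_Suc)
  also have "\<dots> = (\<Prod>i<d. qpoch (a * q * q ^ n * q ^ i) (q ^ d) r)"
  proof (rule prod.reindex_bij_witness[where i = Suc and j = "\<lambda>j. j - 1"])
    fix j assume j: "j \<in> {1..<d+1}"
    then obtain i where i: "j = Suc i"
      by (cases j) auto
    have "q ^ d * a / q powi (int d - int j - int n) = a * q * q ^ n * q ^ (j - 1)"
      using assms i by (simp add: power_int_diff power_int_add field_simps)
    then show "qpoch (a * q * q ^ n * q ^ (j - 1)) (q ^ d) r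
        = qpoch (q ^ d * a / q powi (int d - int j - int n)) (q ^ d) r"
      by simp
  qed auto
  finally show ?thesis
    by (simp add: qpoch_dissection)
qed

lemma vwp_series_mus:
  assumes "q \<noteq> 0" and "d \<ge> 1"
  shows "vwp_series a (xs @ mus d q n) (q ^ d) z =
     (\<Sum>r\<le>n div d.
        qpoch a (q ^ d) r * qpoch (a * q ^ (2 * d)) (q ^ (2 * d)) r
          / (qpoch a (q ^ (2 * d)) r * qpoch (q ^ d) (q ^ d) r)
        * (qpoch (inverse (q ^ n)) q (d * r) / qpoch (a * q * q ^ n) q (d * r))
        * (qpochs xs (q ^ d) r / qpochs (map (\<lambda>x. q ^ d * a / x) xs) (q ^ d) r * z ^ r))"
proof -
  have "qpoch (inverse (q ^ n)) q (d * r) = 0" if "r \<notin> {..n div d}" for r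
  proof -
    have "n < d * r"
      using that assms(2) by (simp add: not_le div_less_iff_less_mult mult.commute)
    then show ?thesis
      using assms(1) by (auto simp: qpoch_eq_0_iff)
  qed
  moreover have "(q ^ d)\<^sup>2 = q ^ (2 * d)"
    by (simp add: mult.commute flip: power_mult)
  ultimately show ?thesis
    unfolding vwp_series_eq map_append qpochs_append qpochs_mus[OF assms(1)]
      qpochs_mus_companion[OF assms(1)]
    by (subst suminf_finite[of "{..n div d}"]) (simp_all add: mult_ac)
qed

section \<open>The confluent limit\<close>

text \<open>
  A factor \<open>\<tau>\<close> turns \<open>1 - (c/\<tau>) q\<^sup>j\<close> into \<open>\<tau> - c q\<^sup>j\<close>, which is continuous at \<open>0\<close>.
\<close>

lemma tendsto_qpoch_rescaled:
  "((\<lambda>\<tau>. \<tau> ^ r * qpoch (c / \<tau>) q r) \<longlongrightarrow> (- c) ^ r * q ^ (r choose 2)) (at 0)"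
proof (induction r)
  case (Suc r)
  have "((\<lambda>\<tau>. \<tau> - c * q ^ r) \<longlongrightarrow> 0 - c * q ^ r) (at 0)"
    by (intro tendsto_intros)
  from tendsto_mult[OF Suc this]
  have "((\<lambda>\<tau>. (\<tau> ^ r * qpoch (c / \<tau>) q r) * (\<tau> - c * q ^ r))
          \<longlongrightarrow> (- c) ^ Suc r * q ^ (Suc r choose 2)) (at 0)"
    by (simp add: numeral_2_eq_2 power_add mult_ac)
  moreover have "\<forall>\<^sub>F \<tau> in at 0. (\<tau> ^ r * qpoch (c / \<tau>) q r) * (\<tau> - c * q ^ r)
                   = \<tau> ^ Suc r * qpoch (c / \<tau>) q (Suc r)"
    by (rule eventually_at_ball'[of 1, THEN eventually_mono])
       (auto simp: qpoch_Suc field_simps)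
  ultimately show ?case
    by (rule Lim_transform_eventually)
qed (simp add: numeral_2_eq_2)

lemma tendsto_qpoch_0:
  "((\<lambda>\<tau>. qpoch (\<tau> * c) q r) \<longlongrightarrow> 1) (at 0)"
proof -
  have "((\<lambda>\<tau>. qpoch (\<tau> * c) q r) \<longlongrightarrow> (\<Prod>j<r. 1 - 0 * c * q ^ j)) (at 0)"
    unfolding qpoch_def by (intro tendsto_intros)
  then show ?thesis by simp
qed

lemma qpow_power: "qpow L x ^ n = qpow L (real n * x)"
  by (simp add: qpow_def mult_ac flip: exp_of_nat_mult)

lemma qpow_add: "qpow L x * qpow L y = qpow L (x + y)"
  by (simp add: qpow_def algebra_simps flip: exp_add)

lemma qpow_uminus: "inverse (qpow L x) = qpow L (- x)"
  by (simp add: qpow_def exp_minus)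

lemma qpow_of_nat:
  assumes "exp L = q"
  shows "q ^ n = qpow L (real n)"
  using assms by (simp add: qpow_def exp_of_nat_mult)

lemma real_choose_2: "real (r choose 2) = real r * (real r - 1) / 2"
proof -
  have "even (r * (r - 1))" by (cases r) auto
  then have "real (r choose 2) = real (r * (r - 1)) / 2"
    by (simp add: choose_two real_of_nat_div)
  then show ?thesis by (cases r) (auto simp: field_simps)
qed

text \<open>
  In the exponent, \<open>r x\<close> comes from \<open>(- c)\<^sup>r\<close> and \<open>h d r (r - 1) / 2 = x r (r - 1)\<close> from the quadratic
  power, so that the linear terms in \<open>r\<close> cancel.  For \<open>h = 0\<close> the balance \<open>h d = 2 x\<close> forces
  \<open>x = 0\<close>, and the quotient \<open>x / h\<close> is harmless.
\<close>

lemma confluent_power: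
  assumes "exp L = q" and "real h * real d = 2 * x"
  shows "((- qpow L (x / real h)) ^ r * (q ^ d) ^ (r choose 2)) ^ h
           = (-1) ^ (h * r) * qpow L (x * real r ^ 2)"
proof -
  have hx: "real h * (x / real h) = x"
    using assms(2) by (cases "h = 0") auto
  have "((- qpow L (x / real h)) ^ r * (q ^ d) ^ (r choose 2)) ^ h
      = (-1) ^ (h * r) * (qpow L (x / real h) ^ h) ^ r * q ^ (d * (r choose 2) * h)"
    unfolding power_minus[of "qpow L (x / real h)"]
    by (simp add: power_mult_distrib mult_ac flip: power_mult)
  also have "\<dots> = (-1) ^ (h * r) * qpow L (real r * x + real (d * (r choose 2) * h))"
    unfolding qpow_power hx qpow_of_nat[OF assms(1)] mult.assoc qpow_add ..
  also have "real (d * (r choose 2) * h) = (real h * real d) * (real r * (real r - 1) / 2)"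
    by (simp add: real_choose_2)
  also have "real r * x + \<dots> = x * real r ^ 2"
    unfolding assms(2) by (simp add: field_simps power2_eq_square)
  finally show ?thesis .
qed

lemma tendsto_nus_factor:
  assumes "exp L = q" and "d \<ge> 1" and "lam d k \<ge> 0"
  shows "((\<lambda>\<tau>. qpochs (nus d k L \<tau>) (q ^ d) r
              / qpochs (map (\<lambda>x. q ^ d * a / x) (nus d k L \<tau>)) (q ^ d) r * (\<tau> ^ hpar d k) ^ r)
           \<longlongrightarrow> (-1) ^ (hpar d k * r) * qpow L (lam d k * real r ^ 2)) (at 0)"
proof -
  define h where "h = hpar d k"
  define c where "c = qpow L (lam d k / real h)"
  have hd: "real h * real d = 2 * lam d k"
    using assms(2,3) by (simp add: h_def real_hpar)
  have "((\<lambda>\<tau>. ((\<tau> ^ r * qpoch (c / \<tau>) (q ^ d) r) / qpoch (\<tau> * (q ^ d * a / c)) (q ^ d) r) ^ h)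
          \<longlongrightarrow> ((- c) ^ r * (q ^ d) ^ (r choose 2) / 1) ^ h) (at 0)"
    by (intro tendsto_intros tendsto_qpoch_rescaled tendsto_qpoch_0) auto
  also have "((- c) ^ r * (q ^ d) ^ (r choose 2) / 1) ^ h
      = (-1) ^ (h * r) * qpow L (lam d k * real r ^ 2)"
    unfolding c_def using confluent_power[OF assms(1) hd] by simp
  finally show ?thesis
    unfolding nus_def h_def[symmetric] c_def[symmetric]
    by (simp add: qpochs_replicate power_mult_distrib power_divide mult_ac flip: power_mult)
qed

text \<open>
  Here the roles of the parameters and their companions are exchanged: the companion of each
  \<open>\<delta>\<^sub>j\<close> is \<open>c/\<tau>\<close> with \<open>c\<close> a power of \<open>q\<close> of exponent \<open>- \<lambda>/h\<close>.  The limit is therefore the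
  reciprocal of the one that \<open>confluent_power\<close> gives for \<open>- \<lambda>\<close>, and it exists because \<open>c \<noteq> 0\<close>.
\<close>

lemma tendsto_deltas_factor:
  assumes "exp L = q" and "d \<ge> 1" and "lam d k < 0" and "a \<noteq> 0"
  shows "((\<lambda>\<tau>. qpochs (deltas d k a L \<tau>) (q ^ d) r
              / qpochs (map (\<lambda>x. q ^ d * a / x) (deltas d k a L \<tau>)) (q ^ d) r
              * inverse (\<tau> ^ hpar d k) ^ r)
           \<longlongrightarrow> (-1) ^ (hpar d k * r) * qpow L (lam d k * real r ^ 2)) (at 0)"
proof -
  define h where "h = hpar d k"
  define e where "e = a * qpow L (real d + lam d k / real h)"
  define c where "c = qpow L (- lam d k / real h)"
  have hd: "real h * real d = 2 * (- lam d k)"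
    using assms(2,3) by (simp add: h_def real_hpar)
  have c0: "c \<noteq> 0" and q0: "q \<noteq> 0"
    using assms(1) by (auto simp: c_def qpow_def)
  have ec: "e * c = q ^ d * a"
    unfolding e_def c_def by (simp add: qpow_add qpow_of_nat[OF assms(1)] mult.assoc)
  have companion: "q ^ d * a / (\<tau> * a * qpow L (real d + lam d k / real h)) = c / \<tau>" for \<tau>
  proof -
    have "e \<noteq> 0" using assms(4) by (simp add: e_def qpow_def)
    moreover have "\<tau> * a * qpow L (real d + lam d k / real h) = \<tau> * e"
      by (simp add: e_def)
    ultimately show ?thesis by (simp only: ec[symmetric]) simp
  qed
  have "((\<lambda>\<tau>. (qpoch (\<tau> * e) (q ^ d) r / (\<tau> ^ r * qpoch (c / \<tau>) (q ^ d) r)) ^ h)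
          \<longlongrightarrow> (1 / ((- c) ^ r * (q ^ d) ^ (r choose 2))) ^ h) (at 0)"
    by (intro tendsto_intros tendsto_qpoch_rescaled tendsto_qpoch_0) (simp add: c0 q0)
  also have "(1 / ((- c) ^ r * (q ^ d) ^ (r choose 2))) ^ h
      = inverse ((-1) ^ (h * r) * qpow L (- lam d k * real r ^ 2))"
    unfolding c_def using confluent_power[OF assms(1) hd]
    by (simp add: power_one_over inverse_eq_divide)
  also have "\<dots> = (-1) ^ (h * r) * qpow L (lam d k * real r ^ 2)"
    by (simp add: qpow_uminus power_inverse[symmetric])
  also have "(\<lambda>\<tau>. (qpoch (\<tau> * e) (q ^ d) r / (\<tau> ^ r * qpoch (c / \<tau>) (q ^ d) r)) ^ h)
      = (\<lambda>\<tau>. qpoch (\<tau> * e) (q ^ d) r ^ h / qpoch (c / \<tau>) (q ^ d) r ^ h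
               * inverse (\<tau> ^ h) ^ r)"
    by (rule ext) (simp add: power_mult_distrib power_divide power_inverse divide_inverse
        mult_ac flip: power_mult)
  finally show ?thesis
    unfolding deltas_def h_def[symmetric] map_replicate companion qpochs_replicate
    by (simp add: e_def mult.assoc)
qed

section \<open>The Bailey pair\<close>

text \<open>
  The integer \<open>h = \<bar>2 k - 3 d + 1\<bar>\<close> has parity opposite to that of \<open>d\<close>, so \<open>h + d\<close> is odd.
\<close>

lemma minus_one_power_hpar:
  assumes "d \<ge> 1"
  shows "(-1 :: complex) ^ (hpar d k * r) * (-1) ^ (d * r) = (-1) ^ r"
proof -
  have "2 * lam d k / real d = of_int (2 * int k - 3 * int d + 1)"
    using assms by (simp add: lam_def field_simps power2_eq_square)
  with real_hpar[OF assms, of k]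
  have "real_of_int (int (hpar d k)) = of_int \<bar>2 * int k - 3 * int d + 1\<bar>"
    by simp
  then have "int (hpar d k) = \<bar>2 * int k - 3 * int d + 1\<bar>"
    using of_int_eq_iff by blast
  then have "even (int (hpar d k)) \<longleftrightarrow> odd (int d)"
    by (simp add: even_abs_add_iff)
  then show ?thesis
    by (cases "even d") (auto simp: minus_one_power_iff)
qed

text \<open>
  The left-hand side is the limit of the term of index \<open>r\<close> of the series, divided by the
  normalising denominator of \<open>\<beta>\<close>.  The exponents match because the half-square
  \<open>d\<^sup>2 r\<^sup>2 / 2\<close> raises the summand \<open>- (3/2) d\<^sup>2\<close> of \<open>\<lambda>\<close> to \<open>- d\<^sup>2\<close>, while
  \<open>- d r / 2\<close> is the linear part.
\<close>

lemma limit_term_eq_alpha: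
  assumes "d \<ge> 1" and "norm q < 1" and "exp L = q" and "d * r \<le> n"
  shows "qpoch a (q ^ d) r * qpoch (a * q ^ (2 * d)) (q ^ (2 * d)) r
          / (qpoch a (q ^ (2 * d)) r * qpoch (q ^ d) (q ^ d) r)
        * (qpoch (inverse (q ^ n)) q (d * r) / qpoch (a * q * q ^ n) q (d * r))
        * ((-1) ^ (hpar d k * r) * qpow L (lam d k * real r ^ 2)
            * (a powi (int k - int d) * q ^ (n * d)) ^ r)
        / (qpoch q q n * qpoch (a * q) q n)
      = bp_alpha d k a q L (d * r) / (qpoch q q (n - d * r) * qpoch (a * q) q (n + d * r))"
proof -
  define m where "m = d * r"
  define A where "A = qpoch a (q ^ d) r * qpoch (a * q ^ (2 * d)) (q ^ (2 * d)) r
          / (qpoch a (q ^ (2 * d)) r * qpoch (q ^ d) (q ^ d) r)"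
  define E where "E = (real d * real k - real d ^ 2 + real d / 2) * real r ^ 2 - real d / 2 * real r"
  have q0: "q \<noteq> 0" using assms(3) by auto
  have nz: "qpoch q q n \<noteq> 0" "qpoch q q (n - m) \<noteq> 0"
    using assms(2) by (simp_all add: qpoch_self_nonzero)
  have "lam d k * real r ^ 2 + real (m choose 2) = E"
    by (simp add: m_def E_def real_choose_2 lam_def field_simps power2_eq_square)
  then have qE: "qpow L (lam d k * real r ^ 2) * q ^ (m choose 2) = qpow L E"
    by (simp add: qpow_of_nat[OF assms(3)] qpow_add)
  have "q ^ (n * m) * qpoch (inverse (q ^ n)) q m * qpoch q q (n - m)
      = (-1) ^ m * q ^ (m choose 2) * qpoch q q n"
    using q0 assms(4) by (intro qpoch_inverse_power) (auto simp: m_def)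
  then have inv: "q ^ (n * m) * qpoch (inverse (q ^ n)) q m / qpoch q q n
      = (-1) ^ m * q ^ (m choose 2) / qpoch q q (n - m)"
    using nz by (simp add: field_simps)
  have "A * (qpoch (inverse (q ^ n)) q m / qpoch (a * q * q ^ n) q m)
        * ((-1) ^ (hpar d k * r) * qpow L (lam d k * real r ^ 2)
            * (a powi (int k - int d) * q ^ (n * d)) ^ r)
        / (qpoch q q n * qpoch (a * q) q n)
      = A * (a powi (int k - int d)) ^ r * (-1) ^ (hpar d k * r) * qpow L (lam d k * real r ^ 2)
        * (q ^ (n * m) * qpoch (inverse (q ^ n)) q m / qpoch q q n)
        / (qpoch (a * q) q n * qpoch (a * q * q ^ n) q m)"
    by (simp add: power_mult_distrib m_def mult_ac flip: power_mult)
  also have "\<dots> = A * (a powi (int k - int d)) ^ r * ((-1) ^ (hpar d k * r) * (-1) ^ m)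
        * (qpow L (lam d k * real r ^ 2) * q ^ (m choose 2))
        / (qpoch q q (n - m) * qpoch (a * q) q (n + m))"
    unfolding inv qpoch_add by simp
  also have "\<dots> = A * (a powi (int k - int d)) ^ r * (-1) ^ r * qpow L E
        / (qpoch q q (n - m) * qpoch (a * q) q (n + m))"
    unfolding qE unfolding m_def minus_one_power_hpar[OF assms(1)] ..
  also have "A * (a powi (int k - int d)) ^ r * (-1) ^ r * qpow L E = bp_alpha d k a q L m"
  proof -
    have "bp_alpha d k a q L m
        = (-1) ^ r * a powi ((int k - int d) * int r) * qpow L E * A"
      using assms(1) by (simp add: bp_alpha_def m_def A_def E_def)
    also have "a powi ((int k - int d) * int r) = (a powi (int k - int d)) ^ r"
      by (simp only: power_int_mult power_int_of_nat)
    finally show ?thesis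
      by (simp only: mult_ac)
  qed
  finally show ?thesis
    unfolding m_def A_def .
qed

lemma bp_beta_pre_tendsto:
  assumes "d \<ge> 1" and "norm q < 1" and "exp L = q"
    and "lam d k < 0 \<Longrightarrow> a \<noteq> 0"
  shows "(bp_beta_pre d k a q L n \<longlongrightarrow>
           (\<Sum>m=0..n. bp_alpha d k a q L m / (qpoch q q (n - m) * qpoch (a * q) q (n + m)))) (at 0)"
proof -
  \<comment> \<open>The two definitions of \<open>\<beta>\<close> differ only in the parameters \<open>xs\<close> and the factor \<open>w\<close> of the
      argument that balances them; \<open>A\<close> and \<open>y\<close> do not involve \<open>\<tau>\<close>.\<close>
  define A where "A r = qpoch a (q ^ d) r * qpoch (a * q ^ (2 * d)) (q ^ (2 * d)) r
          / (qpoch a (q ^ (2 * d)) r * qpoch (q ^ d) (q ^ d) r)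
        * (qpoch (inverse (q ^ n)) q (d * r) / qpoch (a * q * q ^ n) q (d * r))" for r
  define xs where "xs \<tau> = (if lam d k \<ge> 0 then nus d k L \<tau> else deltas d k a L \<tau>)" for \<tau>
  define w where "w \<tau> = (if lam d k \<ge> 0 then \<tau> ^ hpar d k else inverse (\<tau> ^ hpar d k))"
    for \<tau> :: complex
  define y where "y = a powi (int k - int d) * q ^ (n * d)"
  define B where "B r \<tau> = qpochs (xs \<tau>) (q ^ d) r
      / qpochs (map (\<lambda>x. q ^ d * a / x) (xs \<tau>)) (q ^ d) r * w \<tau> ^ r" for r \<tau>
  define D where "D = qpoch q q n * qpoch (a * q) q n"
  let ?B = "\<lambda>r. (-1) ^ (hpar d k * r) * qpow L (lam d k * real r ^ 2)"
  let ?S = "\<lambda>m. bp_alpha d k a q L m / (qpoch q q (n - m) * qpoch (a * q) q (n + m))"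
  have q0: "q \<noteq> 0" using assms(3) by auto
  have Blim: "(B r \<longlongrightarrow> ?B r) (at 0)" for r
    unfolding B_def xs_def w_def
    using tendsto_nus_factor[OF assms(3,1)] tendsto_deltas_factor[OF assms(3,1) _ assms(4)]
    by (cases "lam d k \<ge> 0") (simp_all add: not_le)
  have pre: "bp_beta_pre d k a q L n \<tau> = (\<Sum>r\<le>n div d. A r * (B r \<tau> * y ^ r) / D)" for \<tau>
  proof -
    have "bp_beta_pre d k a q L n \<tau>
        = vwp_series a (xs \<tau> @ mus d q n) (q ^ d) (w \<tau> * y) / D"
      by (simp add: bp_beta_pre_def xs_def w_def y_def D_def field_simps)
    then show ?thesis
      by (simp add: vwp_series_mus[OF q0 assms(1)] A_def B_def power_mult_distrib
               sum_divide_distrib mult_ac)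
  qed
  have "((\<lambda>\<tau>. \<Sum>r\<le>n div d. A r * (B r \<tau> * y ^ r) / D)
          \<longlongrightarrow> (\<Sum>r\<le>n div d. A r * (?B r * y ^ r) / D)) (at 0)"
    unfolding divide_inverse[of _ D] by (intro tendsto_intros Blim)
  also have "(\<Sum>r\<le>n div d. A r * (?B r * y ^ r) / D) = (\<Sum>r\<le>n div d. ?S (d * r))"
  proof (rule sum.cong[OF refl])
    fix r assume "r \<in> {..n div d}"
    then have "d * r \<le> n"
      using assms(1) by (simp add: less_eq_div_iff_mult_less_eq mult.commute)
    from limit_term_eq_alpha[OF assms(1-3) this]
    show "A r * (?B r * y ^ r) / D = ?S (d * r)"
      unfolding A_def y_def D_def .
  qed
  also have "\<dots> = (\<Sum>m\<in>(\<lambda>r. d * r) ` {..n div d}. ?S m)"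
    using assms(1) by (subst sum.reindex) (auto simp: inj_on_def)
  also have "\<dots> = (\<Sum>m=0..n. ?S m)"
  proof (rule sum.mono_neutral_left)
    show "(\<lambda>r. d * r) ` {..n div d} \<subseteq> {0..n}"
      using assms(1) by (auto simp: less_eq_div_iff_mult_less_eq mult.commute)
    show "\<forall>m\<in>{0..n} - (\<lambda>r. d * r) ` {..n div d}. ?S m = 0"
    proof
      fix m assume m: "m \<in> {0..n} - (\<lambda>r. d * r) ` {..n div d}"
      have "\<not> d dvd m"
      proof
        assume "d dvd m"
        then have "m = d * (m div d)" by simp
        moreover have "m div d \<le> n div d" using m by (simp add: div_le_mono)
        ultimately show False using m by blast
      qed
      then show "?S m = 0" by (simp add: bp_alpha_def)
    qed
  qed simp
  finally show ?thesis
    unfolding pre[abs_def] .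
qed

theorem theorem2p1:
  fixes d k :: nat and a q L :: complex
  assumes "d \<ge> 1" and "k \<ge> 1"
    and "norm q < 1" and "exp L = q"
    and "\<And>i::nat. a * q ^ i \<noteq> 1"
    and "lam d k < 0 \<Longrightarrow> a \<noteq> 0"
  shows "(\<forall>n. (bp_beta_pre d k a q L n \<longlongrightarrow> bp_beta d k a q L n) (at 0)) \<and>
         bailey_pair a q (bp_alpha d k a q L) (bp_beta d k a q L)"
proof -
  note lim = bp_beta_pre_tendsto[OF assms(1,3,4,6)]
  have "bp_beta d k a q L n =
      (\<Sum>m=0..n. bp_alpha d k a q L m / (qpoch q q (n - m) * qpoch (a * q) q (n + m)))" for n
    unfolding bp_beta_def by (rule tendsto_Lim[OF _ lim]) simp_all
  then show ?thesis
    using lim by (simp add: bailey_pair_def)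
qed

end
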